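(* Let $\{x_n\}_{n\in\mathbb{N}}$ be a strong divisibility sequence with $x_1=1$, and let $\mathcal{A}=\{n\in\mathbb{N}: x_n=1\}$. Assume that $\mathcal{A}$ has density $0$. Then the set $\{n\in\mathbb{N}: x_n\text{ is prime}\}$ has density $0$.
   Context: $\mathbb{N}$ denotes the positive integers. A strong divisibility sequence (SDS) is a sequence of positive integers $\{x_n\}_{n\in\mathbb{N}}$ such that $\gcd(x_n,x_m)=x_{\gcd(n,m)}$ for all $m,n\geq 1$. A set $S\subseteq\mathbb{N}$ has density $0$ if $\lim_{N\to\infty}\frac1N\#\{n\leq N: n\in S\}=0$ (natural density). *)

theory Defs
  imports Complex_Main "HOL-Computational_Algebra.Primes"
begin

text \<open>
  Sequences indexed by the positive integers are functions on \<^typ>\<open>nat\<close>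
  whose value at \<open>0\<close> is irrelevant.
\<close>

definition strong_divisibility_sequence :: "(nat \<Rightarrow> nat) \<Rightarrow> bool" where
  "strong_divisibility_sequence x \<longleftrightarrow>
     (\<forall>n\<ge>1. x n > 0) \<and> (\<forall>m\<ge>1. \<forall>n\<ge>1. gcd (x n) (x m) = x (gcd n m))"

definition has_natural_density :: "nat set \<Rightarrow> real \<Rightarrow> bool" where
  "has_natural_density S d \<longleftrightarrow>
     (\<lambda>N. real (card {n \<in> {1..N}. n \<in> S}) / real N) \<longlonglongrightarrow> d"

end

theory Submission
  imports Defs
begin

text \<open>
  Let \<open>A\<close> be the set of \<open>n\<close> with \<open>x n = 1\<close>, let \<open>x n = p\<close> be prime, and let \<open>s\<close> be the
  \<open>y\<close>-smooth part of \<open>n\<close>. Every divisor \<open>d\<close> of \<open>n\<close> has \<open>x d = 1\<close> or \<open>x d = p\<close>, and the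
  divisors with \<open>x d = p\<close> are closed under gcd. So if \<open>s\<close> is not in \<open>A\<close>, then removing
  from \<open>n\<close> all factors \<open>q\<close> of some prime \<open>q \<le> y\<close> leads to an element of \<open>A\<close>; for fixed \<open>y\<close>
  this happens on a set of density zero.

  It remains to see that \<open>s \<in> A\<close> is rare when \<open>y\<close> is large. The average of \<open>ln s\<close> is
  \<open>O(ln y)\<close> by Chebyshev's bound, so \<open>s > y ^ C\<close> has density \<open>O(1 / C)\<close>. A value
  \<open>s = a\<close> has density \<open>\<rho> / a\<close>, where \<open>\<rho> = O(1 / ln y)\<close> is the density of the integers coprime to
  \<open>y!\<close>, and the sum of \<open>1 / a\<close> over \<open>a \<in> A\<close> with \<open>a \<le> y ^ C\<close> is \<open>o(C ln y)\<close>.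
\<close>

section \<open>Upper bounds for the density of a set\<close>

definition count_upto :: "nat set \<Rightarrow> nat \<Rightarrow> nat" where
  "count_upto S N = card {n \<in> {1..N}. n \<in> S}"

text \<open>A strong form of upper density at most \<open>c\<close>, with bounded error. A bound for
  every \<open>N\<close> replaces limits by linear inequalities, which add over unions and survive
  passing from \<open>N\<close> to \<open>N div m\<close>.\<close>

definition density_le :: "nat set \<Rightarrow> real \<Rightarrow> bool" where
  "density_le S c \<longleftrightarrow> (\<exists>K. \<forall>N. real (count_upto S N) \<le> c * real N + K)"

lemma density_leI:
  assumes "\<And>N. real (count_upto S N) \<le> c * real N + K"
  shows "density_le S c"
  using assms unfolding density_le_def by blast

lemma count_upto_mono:
  assumes "\<And>n. n \<ge> 1 \<Longrightarrow> n \<in> S \<Longrightarrow> n \<in> T"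
  shows "count_upto S N \<le> count_upto T N"
  unfolding count_upto_def using assms by (intro card_mono) auto

lemma count_upto_Un: "count_upto (S \<union> T) N \<le> count_upto S N + count_upto T N"
proof -
  have "{n \<in> {1..N}. n \<in> S \<union> T} = {n \<in> {1..N}. n \<in> S} \<union> {n \<in> {1..N}. n \<in> T}"
    by blast
  then show ?thesis
    unfolding count_upto_def by (metis card_Un_le)
qed

lemma count_upto_le: "count_upto S N \<le> N"
proof -
  have "card {n \<in> {1..N}. n \<in> S} \<le> card {1..N}"
    by (intro card_mono) auto
  then show ?thesis by (simp add: count_upto_def)
qed

lemma density_le_mono:
  assumes "density_le T c" "\<And>n. n \<ge> 1 \<Longrightarrow> n \<in> S \<Longrightarrow> n \<in> T" "c \<le> d"
  shows "density_le S d"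
proof -
  obtain K where K: "\<And>N. real (count_upto T N) \<le> c * real N + K"
    using assms(1) unfolding density_le_def by blast
  show ?thesis
  proof (rule density_leI)
    fix N
    have "real (count_upto S N) \<le> real (count_upto T N)"
      using count_upto_mono[of S T N] assms(2) by simp
    also have "\<dots> \<le> c * real N + K" by (rule K)
    also have "\<dots> \<le> d * real N + K" using assms(3) by (simp add: mult_right_mono)
    finally show "real (count_upto S N) \<le> d * real N + K" .
  qed
qed

lemma density_le_Un:
  assumes "density_le S c" "density_le T d"
  shows "density_le (S \<union> T) (c + d)"
proof -
  obtain K L where KL: "\<And>N. real (count_upto S N) \<le> c * real N + K"
      "\<And>N. real (count_upto T N) \<le> d * real N + L"
    using assms unfolding density_le_def by blast
  show ?thesis
  proof (rule density_leI)
    fix N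
    have "real (count_upto (S \<union> T) N) \<le> real (count_upto S N) + real (count_upto T N)"
      using count_upto_Un[of S T N] by linarith
    then show "real (count_upto (S \<union> T) N) \<le> (c + d) * real N + (K + L)"
      using KL[of N] by (simp add: algebra_simps)
  qed
qed

lemma density_le_empty: "density_le {} 0"
  by (rule density_leI[where K = 0]) (simp add: count_upto_def)

lemma density_le_UN:
  assumes "finite I" "\<And>i. i \<in> I \<Longrightarrow> density_le (S i) (c i)"
  shows "density_le (\<Union>i\<in>I. S i) (\<Sum>i\<in>I. c i)"
  using assms
  by (induction I rule: finite_induct) (auto intro: density_le_empty density_le_Un)

lemma count_upto_multiples: "m > 0 \<Longrightarrow> count_upto {n. m dvd n \<and> n div m \<in> S} N = count_upto S (N div m)"
proof -
  assume m: "m > 0"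
  have "{n \<in> {1..N}. n \<in> {n. m dvd n \<and> n div m \<in> S}} = (*) m ` {k \<in> {1..N div m}. k \<in> S}"
    (is "?L = ?R")
  proof
    show "?R \<subseteq> ?L" using m by (auto simp: less_eq_div_iff_mult_less_eq mult.commute)
    show "?L \<subseteq> ?R"
    proof
      fix n assume n: "n \<in> ?L"
      then obtain k where k: "n = m * k" by auto
      with n m have "k \<in> {k \<in> {1..N div m}. k \<in> S}"
        by (auto simp: less_eq_div_iff_mult_less_eq mult.commute)
      with k show "n \<in> ?R" by blast
    qed
  qed
  then have "count_upto {n. m dvd n \<and> n div m \<in> S} N = card ((*) m ` {k \<in> {1..N div m}. k \<in> S})"
    by (simp add: count_upto_def)
  also have "\<dots> = count_upto S (N div m)"
    unfolding count_upto_def using m by (intro card_image) (auto simp: inj_on_def)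
  finally show ?thesis .
qed

lemma density_le_multiples:
  assumes "density_le S c" "m > 0" "c \<ge> 0"
  shows "density_le {n. m dvd n \<and> n div m \<in> S} (c / real m)"
proof -
  obtain K where K: "\<And>N. real (count_upto S N) \<le> c * real N + K"
    using assms(1) unfolding density_le_def by blast
  show ?thesis
  proof (rule density_leI)
    fix N
    have "real (count_upto {n. m dvd n \<and> n div m \<in> S} N) \<le> c * real (N div m) + K"
      using K[of "N div m"] by (simp only: count_upto_multiples[OF assms(2)])
    also have "\<dots> \<le> c * (real N / real m) + K"
      by (intro add_right_mono mult_left_mono of_nat_div_le_of_nat assms)
    finally show "real (count_upto {n. m dvd n \<and> n div m \<in> S} N) \<le> c / real m * real N + K"
      by simp
  qed
qed

lemma density_le_1: "density_le S 1"
  by (rule density_leI[where K = 0]) (simp add: count_upto_le)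

text \<open>As \<open>c\<close> is arbitrary, the additive constant is harmless: it absorbs an
  initial segment in one direction, and is dominated by \<open>r / 2 * real n\<close> for large
  \<open>n\<close> in the other.\<close>

lemma density_zero_iff:
  "has_natural_density S 0 \<longleftrightarrow> (\<forall>c>0. density_le S c)"
proof
  assume L: "has_natural_density S 0"
  show "\<forall>c>0. density_le S c"
  proof (intro allI impI)
    fix c :: real assume c: "c > 0"
    have "(\<lambda>N. real (count_upto S N) / real N) \<longlonglongrightarrow> 0"
      using L by (simp add: has_natural_density_def count_upto_def)
    then have "eventually (\<lambda>N. real (count_upto S N) / real N < c) sequentially"
      using c by (simp add: order_tendsto_iff)
    then obtain M where M: "\<And>N. N \<ge> M \<Longrightarrow> real (count_upto S N) / real N < c"
      by (auto simp: eventually_sequentially)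
    show "density_le S c"
    proof (rule density_leI[where K = "real M"])
      fix N
      show "real (count_upto S N) \<le> c * real N + real M"
      proof (cases "N \<ge> M \<and> N > 0")
        case True
        then have "real (count_upto S N) / real N < c" using M by blast
        with True have "real (count_upto S N) < c * real N" by (simp add: divide_less_eq)
        then show ?thesis by simp
      next
        case False
        then have "N \<le> M" by auto
        with count_upto_le[of S N] have "real (count_upto S N) \<le> real M" by simp
        moreover have "0 \<le> c * real N" using c by simp
        ultimately show ?thesis by linarith
      qed
    qed
  qed
next
  assume R: "\<forall>c>0. density_le S c"
  have "(\<lambda>N. real (count_upto S N) / real N) \<longlonglongrightarrow> 0"
  proof (rule LIMSEQ_I)
    fix r :: real assume r: "r > 0"
    then obtain K where K: "\<And>N. real (count_upto S N) \<le> r / 2 * real N + K"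
      using R[rule_format, of "r / 2"] unfolding density_le_def by auto
    obtain M where M: "real M > 2 * K / r" using reals_Archimedean2 by blast
    show "\<exists>no. \<forall>n\<ge>no. norm (real (count_upto S n) / real n - 0) < r"
    proof (intro exI allI impI)
      fix n assume n: "n \<ge> Suc M"
      then have "real n > 2 * K / r" using M by simp
      then have "K < r / 2 * real n" using r by (simp add: field_simps)
      then have "real (count_upto S n) < r * real n" using K[of n] by simp
      then show "norm (real (count_upto S n) / real n - 0) < r"
        using n by (simp add: divide_less_eq)
    qed
  qed
  then show "has_natural_density S 0" by (simp add: has_natural_density_def count_upto_def)
qed

section \<open>Operations that preserve density zero\<close>

lemma density_zero_multiples:
  assumes "has_natural_density S 0" "m > 0"
  shows "has_natural_density {n. m dvd n \<and> n div m \<in> S} 0"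
  unfolding density_zero_iff
proof (intro allI impI)
  fix c :: real assume c: "c > 0"
  with assms have "density_le S (c * real m)" by (simp add: density_zero_iff)
  from density_le_multiples[OF this assms(2)] c assms(2)
  show "density_le {n. m dvd n \<and> n div m \<in> S} c" by simp
qed

lemma density_zero_UN:
  assumes "finite I" "\<And>i. i \<in> I \<Longrightarrow> has_natural_density (S i) 0"
  shows "has_natural_density (\<Union>i\<in>I. S i) 0"
  unfolding density_zero_iff
proof (intro allI impI)
  fix c :: real assume c: "c > 0"
  \<comment> \<open>\<open>Suc\<close> keeps the denominator positive when \<open>I\<close> is
    empty.\<close>
  define e where "e = c / real (Suc (card I))"
  have "e > 0" using c by (simp add: e_def)
  then have "density_le (\<Union>i\<in>I. S i) (\<Sum>i\<in>I. e)"
    using assms by (intro density_le_UN) (auto simp: density_zero_iff)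
  moreover have "(\<Sum>i\<in>I. e) \<le> c" using c by (simp add: e_def field_simps)
  ultimately show "density_le (\<Union>i\<in>I. S i) c" by (auto intro: density_le_mono)
qed

text \<open>Split by the multiplicity \<open>j\<close> of \<open>q\<close> in \<open>n\<close>. Each
  \<open>j < J\<close> gives a dilate of \<open>A\<close>, of density zero; the remaining
  \<open>n\<close> are multiples of \<open>q ^ J\<close>, which are rare for large
  \<open>J\<close>.\<close>

lemma density_zero_remove_prime:
  assumes A: "has_natural_density A 0" and q: "prime q"
  shows "has_natural_density {n. n div q ^ multiplicity q n \<in> A} 0"
  unfolding density_zero_iff
proof (intro allI impI)
  fix c :: real assume c: "c > 0"
  \<comment> \<open>Since \<open>J < 2 ^ J \<le> q ^ J\<close>, the bound
    \<open>J \<ge> 2 / c\<close> already makes the multiples of \<open>q ^ J\<close> contribute at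
    most \<open>c / 2\<close>.\<close>
  define J where "J = nat \<lceil>2 / c\<rceil>"
  have q2: "q \<ge> 2" using q by (simp add: prime_ge_2_nat)
  have J: "1 / real (q ^ J) \<le> c / 2"
  proof -
    have "J < 2 ^ J" by simp
    also have "(2::nat) ^ J \<le> q ^ J" using q2 by (simp add: power_mono)
    finally have "real J \<le> real (q ^ J)" by simp
    moreover have "2 / c \<le> real J" unfolding J_def by linarith
    ultimately have "2 / c \<le> real (q ^ J)" by linarith
    then show ?thesis using c q2 by (simp add: field_simps)
  qed
  have "has_natural_density (\<Union>j\<in>{..<J}. {n. q ^ j dvd n \<and> n div q ^ j \<in> A}) 0"
    using q2 by (intro density_zero_UN density_zero_multiples A) auto
  then have 1: "density_le (\<Union>j\<in>{..<J}. {n. q ^ j dvd n \<and> n div q ^ j \<in> A}) (c / 2)"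
    using c by (simp add: density_zero_iff)
  have 2: "density_le {n. q ^ J dvd n \<and> n div q ^ J \<in> UNIV} (1 / real (q ^ J))"
    using q2 by (intro density_le_multiples density_le_1) auto
  from J have s: "c / 2 + 1 / real (q ^ J) \<le> c" by linarith
  show "density_le {n. n div q ^ multiplicity q n \<in> A} c"
  proof (rule density_le_mono[OF density_le_Un[OF 1 2] _ s])
    fix n :: nat assume "n \<ge> 1" and n: "n \<in> {n. n div q ^ multiplicity q n \<in> A}"
    show "n \<in> (\<Union>j\<in>{..<J}. {n. q ^ j dvd n \<and> n div q ^ j \<in> A}) \<union>
      {n. q ^ J dvd n \<and> n div q ^ J \<in> UNIV}"
    proof (cases "multiplicity q n < J")
      case True
      with n show ?thesis by (auto intro!: UnI1 bexI[of _ "multiplicity q n"] multiplicity_dvd)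
    next
      case False
      then show ?thesis by (auto intro: multiplicity_dvd')
    qed
  qed
qed

section \<open>Logarithmic sums\<close>

lemma sum_dyadic_split:
  fixes f :: "nat \<Rightarrow> real"
  shows "(\<Sum>n\<in>{1..2 ^ Suc k}. f n) = (\<Sum>n\<in>{1..2 ^ k}. f n) + (\<Sum>n\<in>{2 ^ k<..2 ^ Suc k}. f n)"
proof -
  have "{1..2 ^ Suc k} = {1..2 ^ k} \<union> {2 ^ k<..2 ^ Suc k :: nat}"
    using one_le_power[of "2::nat" k] by auto
  then show ?thesis by (simp only:) (rule sum.union_disjoint, auto)
qed

text \<open>Each dyadic block has \<open>2 ^ k\<close> terms, all at least
  \<open>1 / 2 ^ Suc k\<close>, so it adds at least 1/2.\<close>

lemma harmonic_dyadic_ge: "(\<Sum>n\<in>{1..2 ^ k}. 1 / real n) \<ge> real k / 2"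
proof (induction k)
  case (Suc k)
  have "(\<Sum>n\<in>{2 ^ k<..2 ^ Suc k}. 1 / real n) \<ge> (\<Sum>n\<in>{2 ^ k<..2 ^ Suc k :: nat}. 1 / 2 ^ Suc k)"
  proof (intro sum_mono divide_left_mono)
    fix n :: nat assume n: "n \<in> {2 ^ k<..2 ^ Suc k}"
    then have "real n \<le> real (2 ^ Suc k)" by (simp only: of_nat_le_iff) auto
    then show "real n \<le> 2 ^ Suc k" by simp
    show "0 < (2::real) ^ Suc k * real n" using n by auto
  qed simp
  also have "(\<Sum>n\<in>{2 ^ k<..2 ^ Suc k :: nat}. 1 / 2 ^ Suc k) = (1 / 2 :: real)"
    by simp
  finally show ?case using Suc unfolding sum_dyadic_split by simp
qed simp

text \<open>Dyadic blocks replace partial summation: the block after \<open>2 ^ m\<close> has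
  weights at most \<open>1 / 2 ^ m\<close>, so it adds at most \<open>\<delta> + K / 2 ^ m\<close>,
  and these errors form a convergent geometric series.\<close>

lemma log_sum_density_zero:
  assumes "has_natural_density A 0" "\<delta> > 0"
  obtains K where "\<And>m. (\<Sum>a\<in>{a\<in>{1..2 ^ m}. a \<in> A}. 1 / real a) \<le> \<delta> * real m + K"
proof -
  \<comment> \<open>Half of \<open>\<delta>\<close>, because elements up to \<open>2 ^ Suc m\<close>
    are counted with weight \<open>1 / 2 ^ m\<close>.\<close>
  obtain K where K: "\<And>N. real (count_upto A N) \<le> \<delta> / 2 * real N + K"
    using assms unfolding density_zero_iff density_le_def by (meson half_gt_zero)
  have K0: "K \<ge> 0" using K[of 0] by simp
  define f where "f a = (if a \<in> A then 1 / real a else 0)" for a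
  have eq: "(\<Sum>a\<in>{a\<in>{1..N}. a \<in> A}. 1 / real a) = (\<Sum>a\<in>{1..N}. f a)" for N
    unfolding f_def by (rule sum.inter_filter) simp
  \<comment> \<open>The subtracted term is the tail of the series of errors \<open>K / 2 ^ j\<close>
    from \<open>j = m\<close> on, which lets the induction close. At \<open>m = 0\<close> the
    constant reduces to 1, a bound for \<open>f 1\<close>.\<close>
  have "(\<Sum>a\<in>{1..2 ^ m}. f a) \<le> \<delta> * real m + (1 + 2 * K - K / 2 ^ m * 2)" for m
  proof (induction m)
    case 0
    then show ?case by (simp add: f_def)
  next
    case (Suc m)
    have "(\<Sum>a\<in>{2 ^ m<..2 ^ Suc m}. f a) \<le> (\<Sum>a\<in>{2 ^ m<..2 ^ Suc m}. if a \<in> A then 1 / 2 ^ m else 0)"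
    proof (intro sum_mono)
      fix a :: nat assume a: "a \<in> {2 ^ m<..2 ^ Suc m}"
      then have "real (2 ^ m) \<le> real a" by (simp only: of_nat_le_iff) auto
      then have "1 / real a \<le> 1 / 2 ^ m" using a by (intro divide_left_mono mult_pos_pos) auto
      then show "f a \<le> (if a \<in> A then 1 / 2 ^ m else 0)" by (simp add: f_def)
    qed
    also have "\<dots> \<le> (\<Sum>a\<in>{1..2 ^ Suc m}. if a \<in> A then 1 / 2 ^ m else 0)"
      by (intro sum_mono2) auto
    also have "\<dots> = real (count_upto A (2 ^ Suc m)) / 2 ^ m"
      by (simp add: count_upto_def flip: sum.inter_filter)
    also have "\<dots> \<le> (\<delta> / 2 * real (2 ^ Suc m) + K) / 2 ^ m"
      by (intro divide_right_mono K) simp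
    also have "\<dots> = \<delta> + K / 2 ^ m" by (simp add: field_simps)
    finally have "(\<Sum>a\<in>{2 ^ m<..2 ^ Suc m}. f a) \<le> \<delta> + K / 2 ^ m" .
    moreover have "K / 2 ^ Suc m * 2 = K / 2 ^ m" by simp
    moreover have "\<delta> * real (Suc m) = \<delta> * real m + \<delta>" by (simp add: algebra_simps)
    ultimately show ?case using Suc unfolding sum_dyadic_split by linarith
  qed
  moreover have "K / 2 ^ m * 2 \<ge> 0" for m :: nat using K0 by simp
  ultimately have "(\<Sum>a\<in>{1..2 ^ m}. f a) \<le> \<delta> * real m + (1 + 2 * K)" for m
    by (smt (verit, best))
  then show thesis using that[of "1 + 2 * K"] unfolding eq by blast
qed

text \<open>The primes in \<open>(n, 2n]\<close> divide the central binomial coefficient, which is at most \<open>4 ^ n\<close>.\<close>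

lemma sum_ln_primes_dyadic:
  assumes n: "n > 0"
  shows "(\<Sum>p | prime p \<and> p \<in> {n<..2 * n}. ln (real p)) \<le> real n * ln 4"
proof -
  let ?P = "{p. prime p \<and> p \<in> {n<..2 * n}}"
  have fin: "finite ?P" by (rule finite_subset[of _ "{..2 * n}"]) auto
  have "\<Prod>?P dvd (2 * n choose n)"
  proof (rule multiplicity_le_imp_dvd)
    show "\<Prod>?P \<noteq> 0" using fin by (auto simp: prod_zero_iff)
    fix q :: nat assume q: "prime q"
    have "multiplicity q (\<Prod>?P) = (if q \<in> ?P then 1 else 0)"
      using multiplicity_prod_prime_powers[OF fin _ q, of "\<lambda>_. 1"] by (simp only: power_one_right mem_Collect_eq)
    also have "\<dots> \<le> multiplicity q (2 * n choose n)"
    proof (cases "q \<in> ?P")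
      case True
      then have "q dvd fact (2 * n)" "\<not> q dvd fact n" using q by (auto simp: prime_dvd_fact_iff)
      moreover have "fact n * fact (2 * n - n) * (2 * n choose n) = fact (2 * n)"
        by (rule binomial_fact_lemma) simp
      ultimately have "q dvd (2 * n choose n)" using q
        by (metis add_diff_cancel_left' mult_2 prime_dvd_mult_iff)
      then have "multiplicity q (2 * n choose n) > 0"
        by (simp add: prime_multiplicity_gt_zero_iff q)
      then show ?thesis by simp
    qed (simp only: if_False)
    finally show "multiplicity q (\<Prod>?P) \<le> multiplicity q (2 * n choose n)" .
  qed
  then have "\<Prod>?P \<le> (2 * n choose n)" by (intro dvd_imp_le) auto
  also have "\<dots> \<le> 2 ^ (2 * n)" by (rule binomial_le_pow2)
  finally have "real (\<Prod>?P) \<le> real (2 ^ (2 * n))" by (simp only: of_nat_le_iff)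
  then have "(\<Prod>p\<in>?P. real p) \<le> 4 ^ n" by (simp add: power_mult)
  moreover have "(\<Prod>p\<in>?P. real p) > 0" by (intro prod_pos) (auto dest: prime_gt_0_nat)
  ultimately have "ln (\<Prod>p\<in>?P. real p) \<le> ln (4 ^ n)" by simp
  moreover have "ln (\<Prod>p\<in>?P. real p) = (\<Sum>p\<in>?P. ln (real p))"
    using fin by (intro ln_prod) (auto dest: prime_gt_0_nat)
  ultimately show ?thesis by (simp add: ln_realpow)
qed

text \<open>Each dyadic block of primes contributes at most \<open>ln 4\<close>. The weight
  \<open>1 / (p - 1)\<close> is the sum of all \<open>1 / p ^ j\<close> with
  \<open>j \<ge> 1\<close>, which bounds the average multiplicity of \<open>p\<close>.\<close>

lemma sum_ln_over_primes_le:
  "(\<Sum>p | prime p \<and> p \<le> 2 ^ k. ln (real p) / real (p - 1)) \<le> real k * ln 4"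
proof (induction k)
  case 0
  have no: "{p::nat. prime p \<and> p \<le> 2 ^ 0} = {}" by (auto dest: prime_ge_2_nat)
  show ?case unfolding no by simp
next
  case (Suc k)
  let ?P = "{p. prime p \<and> p \<in> {2 ^ k<..2 * 2 ^ k :: nat}}"
  \<comment> \<open>From \<open>p > 2 ^ k\<close> follows \<open>p - 1 \<ge> 2 ^ k\<close>.\<close>
  have "(\<Sum>p\<in>?P. ln (real p) / real (p - 1)) \<le> (\<Sum>p\<in>?P. ln (real p) / real (2 ^ k))"
    by (intro sum_mono divide_left_mono) (auto dest: prime_gt_0_nat simp flip: of_nat_power)
  also have "\<dots> = (\<Sum>p\<in>?P. ln (real p)) / real (2 ^ k)" by (simp add: sum_divide_distrib)
  also have "\<dots> \<le> real (2 ^ k) * ln 4 / real (2 ^ k)"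
    by (intro divide_right_mono sum_ln_primes_dyadic) auto
  also have "\<dots> = ln 4" by simp
  finally have 1: "(\<Sum>p\<in>?P. ln (real p) / real (p - 1)) \<le> ln 4" .
  have "{p. prime p \<and> p \<le> 2 ^ Suc k} = {p. prime p \<and> p \<le> 2 ^ k} \<union> ?P" by auto
  then have "(\<Sum>p | prime p \<and> p \<le> 2 ^ Suc k. ln (real p) / real (p - 1)) =
    (\<Sum>p | prime p \<and> p \<le> 2 ^ k. ln (real p) / real (p - 1)) + (\<Sum>p\<in>?P. ln (real p) / real (p - 1))"
    by (simp only:) (intro sum.union_disjoint, auto intro: finite_subset[of _ "{..2 * 2 ^ k}"])
  with 1 Suc show ?case by (simp add: algebra_simps)
qed

text \<open>Legendre's bound for the exponent of \<open>p\<close> in \<open>N!\<close>. Only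
  multiples \<open>p * k\<close> contribute, each with one more than the multiplicity in
  \<open>k\<close>, so the sum up to \<open>N\<close> reduces to the sum up to
  \<open>N div p\<close>.\<close>

lemma sum_multiplicity_le:
  fixes p :: nat
  assumes p: "prime p"
  shows "(p - 1) * (\<Sum>n=1..N. multiplicity p n) \<le> N"
proof (induction N rule: less_induct)
  case (less N)
  have p2: "p \<ge> 2" using p by (simp add: prime_ge_2_nat)
  show ?case
  proof (cases "N = 0")
    case False
    let ?M = "N div p"
    have inj: "inj_on ((*) p) {1..?M}" using p2 by (auto simp: inj_on_def)
    have sub: "(*) p ` {1..?M} \<subseteq> {1..N}"
      using p2 by (auto simp: less_eq_div_iff_mult_less_eq mult.commute)
    have "(\<Sum>n=1..N. multiplicity p n) = (\<Sum>n\<in>(*) p ` {1..?M}. multiplicity p n)"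
    proof (rule sum.mono_neutral_right[OF _ sub], simp, safe)
      fix n assume n: "n \<in> {1..N}" "n \<notin> (*) p ` {1..?M}"
      have "\<not> p dvd n"
      proof
        assume "p dvd n"
        then obtain k where "n = p * k" by auto
        with n p2 show False by (auto simp: less_eq_div_iff_mult_less_eq mult.commute)
      qed
      then show "multiplicity p n = 0" by (rule not_dvd_imp_multiplicity_0)
    qed
    also have "\<dots> = (\<Sum>k=1..?M. multiplicity p (p * k))"
      using inj by (simp add: sum.reindex)
    also have "\<dots> = (\<Sum>k=1..?M. 1 + multiplicity p k)"
      using p by (intro sum.cong) (auto simp: prime_elem_multiplicity_mult_distrib)
    also have "\<dots> = ?M + (\<Sum>k=1..?M. multiplicity p k)" by (simp only: sum.distrib) simp
    finally have "(p - 1) * (\<Sum>n=1..N. multiplicity p n) =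
      (p - 1) * ?M + (p - 1) * (\<Sum>k=1..?M. multiplicity p k)" by (simp add: algebra_simps)
    also have "\<dots> \<le> (p - 1) * ?M + ?M"
      using False p2 by (intro add_left_mono less) auto
    also have "\<dots> = p * ?M" using p2 by (simp add: algebra_simps)
    also have "\<dots> \<le> N" by simp
    finally show ?thesis .
  qed simp
qed

section \<open>Smooth parts\<close>

definition smooth_part :: "nat \<Rightarrow> nat \<Rightarrow> nat" where
  "smooth_part y n = (\<Prod>p | prime p \<and> p \<le> y. p ^ multiplicity p n)"

lemma finite_primes_le: "finite {p::nat. prime p \<and> p \<le> y}"
  by (rule finite_subset[of _ "{..y}"]) auto

lemma smooth_part_pos: "smooth_part y n > 0"
  unfolding smooth_part_def by (intro prod_pos) (auto dest: prime_gt_0_nat)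

lemma multiplicity_smooth_part:
  "prime q \<Longrightarrow> multiplicity q (smooth_part y n) = (if q \<le> y then multiplicity q n else 0)"
  unfolding smooth_part_def
  by (subst multiplicity_prod_prime_powers) (auto simp: finite_primes_le)

lemma smooth_part_dvd: "smooth_part y n dvd n"
  using smooth_part_pos[of y n]
  by (intro multiplicity_le_imp_dvd) (auto simp: multiplicity_smooth_part)

text \<open>The primes dividing \<open>y!\<close> are those up to \<open>y\<close>, and the smooth
  part already contains their full powers in \<open>n\<close>.\<close>

lemma coprime_div_smooth_part:
  assumes "n > 0"
  shows "coprime (n div smooth_part y n) (fact y)"
proof (rule ccontr)
  define m where "m = n div smooth_part y n"
  have n: "n = smooth_part y n * m" using smooth_part_dvd[of y n] by (simp add: m_def)
  then have m: "m \<noteq> 0" using assms by (intro notI) simp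
  assume "\<not> coprime (n div smooth_part y n) (fact y)"
  then have "gcd m (fact y) \<noteq> 1" by (simp add: m_def coprime_iff_gcd_eq_1)
  then obtain q where "prime q" "q dvd gcd m (fact y)" using prime_factor_nat by blast
  then have q: "prime q" "q dvd m" "q dvd fact y" by auto
  have "multiplicity q n = multiplicity q (smooth_part y n * m)" using n by simp
  also have "\<dots> = multiplicity q n + multiplicity q m"
    using q m smooth_part_pos[of y n]
    by (simp add: prime_elem_multiplicity_mult_distrib multiplicity_smooth_part prime_dvd_fact_iff)
  finally have "multiplicity q m = 0" by simp
  moreover have "multiplicity q m > 0" using q m by (simp add: prime_multiplicity_gt_zero_iff)
  ultimately show False by simp
qed

text \<open>Write the logarithm as a sum over primes, exchange the sums and apply
  \<open>sum_multiplicity_le\<close> to each prime.\<close>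

lemma sum_ln_smooth_part_le:
  "(\<Sum>n=1..N. ln (real (smooth_part y n))) \<le>
    real N * (\<Sum>p | prime p \<and> p \<le> y. ln (real p) / real (p - 1))"
proof -
  let ?P = "{p. prime p \<and> p \<le> y}"
  have "ln (real (smooth_part y n)) = (\<Sum>p\<in>?P. real (multiplicity p n) * ln (real p))" for n
  proof -
    have "ln (real (smooth_part y n)) = (\<Sum>p\<in>?P. ln (real p ^ multiplicity p n))"
      unfolding smooth_part_def of_nat_prod of_nat_power
      using finite_primes_le[of y] by (intro ln_prod) (auto dest: prime_gt_0_nat)
    also have "\<dots> = (\<Sum>p\<in>?P. real (multiplicity p n) * ln (real p))"
      by (intro sum.cong) (auto simp: ln_realpow dest: prime_gt_0_nat)
    finally show ?thesis .
  qed
  then have "(\<Sum>n=1..N. ln (real (smooth_part y n))) =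
      (\<Sum>n=1..N. \<Sum>p\<in>?P. real (multiplicity p n) * ln (real p))" by simp
  also have "\<dots> = (\<Sum>p\<in>?P. real (\<Sum>n=1..N. multiplicity p n) * ln (real p))"
    by (subst sum.swap) (simp add: sum_distrib_right)
  also have "\<dots> \<le> (\<Sum>p\<in>?P. real N * (ln (real p) / real (p - 1)))"
  proof (intro sum_mono)
    fix p assume "p \<in> ?P"
    then have p: "prime p" "p \<ge> 2" by (auto dest: prime_ge_2_nat)
    have "real ((p - 1) * (\<Sum>n=1..N. multiplicity p n)) \<le> real N"
      using sum_multiplicity_le[OF p(1)] by (simp only: of_nat_le_iff)
    then have "real (\<Sum>n=1..N. multiplicity p n) \<le> real N / real (p - 1)"
      using p(2) by (simp add: field_simps)
    then have "real (\<Sum>n=1..N. multiplicity p n) * ln (real p) \<le> real N / real (p - 1) * ln (real p)"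
      using p(2) by (intro mult_right_mono) auto
    then show "real (\<Sum>n=1..N. multiplicity p n) * ln (real p) \<le> real N * (ln (real p) / real (p - 1))"
      by simp
  qed
  finally show ?thesis by (simp add: sum_distrib_left)
qed

text \<open>Markov's inequality for the logarithm of the smooth part.\<close>

lemma density_le_smooth_part_gt:
  assumes "L > 1"
  shows "density_le {n. smooth_part (2 ^ k) n > L} (real k * ln 4 / ln (real L))"
proof (rule density_leI[where K = 0])
  fix N
  let ?y = "2 ^ k :: nat"
  have L: "ln (real L) > 0" using assms by simp
  have "real (count_upto {n. smooth_part ?y n > L} N) * ln (real L) =
      (\<Sum>n\<in>{n\<in>{1..N}. smooth_part ?y n > L}. ln (real L))"
    by (simp add: count_upto_def)
  also have "\<dots> \<le> (\<Sum>n\<in>{n\<in>{1..N}. smooth_part ?y n > L}. ln (real (smooth_part ?y n)))"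
    using assms by (intro sum_mono) auto
  also have "\<dots> \<le> (\<Sum>n=1..N. ln (real (smooth_part ?y n)))"
  proof (rule sum_mono2)
    fix n
    have "real (smooth_part ?y n) \<ge> 1" using smooth_part_pos[of ?y n] by linarith
    then show "0 \<le> ln (real (smooth_part ?y n))" by simp
  qed auto
  also have "\<dots> \<le> real N * (real k * ln 4)"
    by (rule order_trans[OF sum_ln_smooth_part_le]) (intro mult_left_mono sum_ln_over_primes_le, simp)
  finally show "real (count_upto {n. smooth_part ?y n > L} N) \<le> real k * ln 4 / ln (real L) * real N + 0"
    using L by (simp add: field_simps)
qed

section \<open>Integers coprime to a factorial\<close>

text \<open>With Euler's totient this is \<open>totient (y!) / y!\<close>, the proportion of
  residues modulo \<open>y!\<close> that are units.\<close>

definition rough_density :: "nat \<Rightarrow> real" where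
  "rough_density y = real (count_upto {m. coprime m (fact y)} (fact y)) / fact y"

text \<open>Coprimality to \<open>W\<close> depends only on the residue modulo \<open>W\<close>, so
  every block of length \<open>W\<close> has the same count.\<close>

lemma count_upto_coprime_periodic:
  "count_upto {m. coprime m W} (k * W) = k * count_upto {m. coprime m W} W"
proof (induction k)
  case (Suc k)
  let ?A = "{m \<in> {1..k * W}. coprime m W}" and ?B = "{m \<in> {1..W}. coprime m W}"
  have shift: "coprime (m + k * W) W \<longleftrightarrow> coprime m W" for m
    by (metis coprime_iff_gcd_eq_1 gcd.commute add.commute gcd_add_mult)
  have "{m \<in> {1..Suc k * W}. coprime m W} = ?A \<union> (\<lambda>m. m + k * W) ` ?B" (is "?L = ?R")
  proof
    show "?R \<subseteq> ?L" by (auto simp: shift)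
    show "?L \<subseteq> ?R"
    proof
      fix m assume m: "m \<in> ?L"
      show "m \<in> ?R"
      proof (cases "m \<le> k * W")
        case False
        then have eq: "m = (m - k * W) + k * W" by simp
        have "coprime (m - k * W) W" using m shift[of "m - k * W"] eq by simp
        with m False have "m - k * W \<in> ?B" by auto
        with eq show ?thesis by blast
      qed (use m in auto)
    qed
  qed
  moreover have "card (?A \<union> (\<lambda>m. m + k * W) ` ?B) = card ?A + card ((\<lambda>m. m + k * W) ` ?B)"
    by (intro card_Un_disjoint) auto
  moreover have "card ((\<lambda>m. m + k * W) ` ?B) = card ?B" by (intro card_image) auto
  ultimately show ?case using Suc by (simp add: count_upto_def)
qed (simp add: count_upto_def)

text \<open>Rounding \<open>N\<close> up to a multiple of the period \<open>y!\<close> costs at most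
  one extra period, which is the additive constant.\<close>

lemma density_le_rough: "density_le {m. coprime m (fact y)} (rough_density y)"
proof (rule density_leI[where K = "real (count_upto {m. coprime m (fact y)} (fact y))"])
  fix N
  define W :: nat where "W = fact y"
  define S where "S = {m. coprime m W}"
  have W: "W > 0" by (simp add: W_def)
  have "N \<le> (N div W + 1) * W" using W by (metis add.commute dividend_less_div_times less_imp_le mult_Suc Suc_eq_plus1)
  then have "count_upto S N \<le> count_upto S ((N div W + 1) * W)"
    unfolding count_upto_def by (intro card_mono) auto
  also have "\<dots> = (N div W + 1) * count_upto S W"
    unfolding S_def by (rule count_upto_coprime_periodic)
  finally have "real (count_upto S N) \<le> real ((N div W + 1) * count_upto S W)"
    by (simp only: of_nat_le_iff)
  also have "\<dots> = real (N div W) * real (count_upto S W) + real (count_upto S W)"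
    by (simp add: algebra_simps)
  also have "\<dots> \<le> real N / real W * real (count_upto S W) + real (count_upto S W)"
    by (intro add_right_mono mult_right_mono of_nat_div_le_of_nat) simp
  finally show "real (count_upto {m. coprime m (fact y)} N) \<le>
      rough_density y * real N + real (count_upto {m. coprime m (fact y)} (fact y))"
    by (simp add: rough_density_def W_def S_def mult.commute)
qed

text \<open>
  The products \<open>s m\<close> with \<open>s \<le> y\<close> and \<open>m\<close> coprime to \<open>y!\<close> are pairwise distinct.
\<close>

lemma rough_density_harmonic_le: "rough_density y * (\<Sum>s\<in>{1..y}. 1 / real s) \<le> 1"
proof -
  define W :: nat where "W = fact y"
  have W: "W > 0" by (simp add: W_def)
  have dW: "s dvd W" if "s \<in> {1..y}" for s using that by (auto simp: W_def dvd_fact)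
  define S where "S = {m. coprime m W}"
  define \<phi> where "\<phi> = count_upto S W"
  \<comment> \<open>The cutoff for \<open>m\<close> is a multiple of \<open>W\<close>, so the count
    is exact, and it keeps \<open>s * m \<le> W * W\<close>.\<close>
  define X where "X = (SIGMA s:{1..y}. {m\<in>{1..(W div s) * W}. m \<in> S})"
  have "inj_on (\<lambda>(s, m). s * m) X"
  proof (rule inj_onI, clarify)
    fix s m t n assume sm: "(s, m) \<in> X" and tn: "(t, n) \<in> X" and eq: "s * m = t * n"
    have st: "s \<in> {1..y}" "t \<in> {1..y}" using sm tn by (auto simp: X_def)
    have "coprime W n" "coprime W m"
      using sm tn by (auto simp: X_def S_def coprime_commute)
    \<comment> \<open>As \<open>s\<close> and \<open>t\<close> divide \<open>W\<close>, they are
      coprime to the cofactors; \<open>s * m = t * n\<close> then makes \<open>s\<close> and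
      \<open>t\<close> divide each other.\<close>
    then have "coprime s n" "coprime t m"
      using coprime_divisors[OF dW[OF st(1)] dvd_refl] coprime_divisors[OF dW[OF st(2)] dvd_refl]
      by blast+
    moreover have "s dvd t * n" "t dvd s * m" using eq by (metis dvd_triv_left)+
    ultimately have "s dvd t" "t dvd s" by (simp_all add: coprime_dvd_mult_left_iff)
    then have "s = t" by (rule dvd_antisym)
    with eq st show "s = t \<and> m = n" by simp
  qed
  moreover have "(\<lambda>(s, m). s * m) ` X \<subseteq> {1..W * W}"
  proof clarify
    fix s m assume "(s, m) \<in> X"
    then have s: "s \<in> {1..y}" and m: "1 \<le> m" "m \<le> W div s * W" by (auto simp: X_def)
    have "s * m \<le> s * (W div s * W)" using m by simp
    also have "\<dots> = W * W" using dW[OF s] by (simp flip: mult.assoc)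
    finally show "s * m \<in> {1..W * W}" using s m by simp
  qed
  ultimately have "card X \<le> card {1..W * W}"
    by (metis card_image card_mono finite_atLeastAtMost)
  moreover have "card X = (\<Sum>s\<in>{1..y}. (W div s) * \<phi>)"
  proof -
    have "card X = (\<Sum>s\<in>{1..y}. count_upto S ((W div s) * W))"
      unfolding X_def count_upto_def by (rule card_SigmaI) auto
    then show ?thesis by (simp only: \<phi>_def S_def count_upto_coprime_periodic)
  qed
  ultimately have "real (\<Sum>s\<in>{1..y}. (W div s) * \<phi>) \<le> real (W * W)"
    by (simp only: of_nat_le_iff card_atLeastAtMost diff_Suc_1)
  also have "real (\<Sum>s\<in>{1..y}. (W div s) * \<phi>) = (\<Sum>s\<in>{1..y}. real W * real \<phi> * (1 / real s))"
    unfolding of_nat_sum using dW by (intro sum.cong) (auto simp: real_of_nat_div)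
  also have "\<dots> = real W * real \<phi> * (\<Sum>s\<in>{1..y}. 1 / real s)" by (simp add: sum_distrib_left)
  finally have "real \<phi> * (\<Sum>s\<in>{1..y}. 1 / real s) \<le> real W"
    using W by (simp add: mult.assoc)
  then have "real \<phi> / real W * (\<Sum>s\<in>{1..y}. 1 / real s) \<le> 1"
    using W by (simp add: divide_le_eq)
  then show ?thesis by (simp add: rough_density_def \<phi>_def S_def W_def)
qed

text \<open>Such \<open>n\<close> are \<open>s * m\<close> with \<open>m\<close> coprime to
  \<open>y!\<close>, a dilate of a set of density \<open>rough_density y\<close>.\<close>

lemma density_le_smooth_part_eq:
  assumes "s > 0"
  shows "density_le {n. smooth_part y n = s} (rough_density y / real s)"
proof (rule density_le_mono)
  show "density_le {n. s dvd n \<and> n div s \<in> {m. coprime m (fact y)}} (rough_density y / real s)"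
    using assms by (intro density_le_multiples density_le_rough) (auto simp: rough_density_def)
  show "n \<in> {n. s dvd n \<and> n div s \<in> {m. coprime m (fact y)}}"
    if "n \<ge> 1" "n \<in> {n. smooth_part y n = s}" for n
    using that smooth_part_dvd[of y n] coprime_div_smooth_part[of n y] by auto
qed simp

lemma density_smooth_part_mem:
  assumes A: "has_natural_density A 0" and \<epsilon>: "\<epsilon> > 0"
  obtains y where "density_le {n. smooth_part y n \<in> A} \<epsilon>"
proof -
  \<comment> \<open>The budget is three times \<open>\<epsilon> / 3\<close>: for smooth parts above
    \<open>y ^ C\<close>, for the term in \<open>\<delta>\<close>, and for \<open>K\<close>. Thus
    \<open>C\<close> is fixed first, then \<open>\<delta>\<close> and its \<open>K\<close>, and only
    then \<open>k\<close>.\<close>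
  obtain C0 where C0: "real C0 > 6 / \<epsilon>" using reals_Archimedean2 by blast
  define C where "C = Suc C0"
  have C: "C > 0" "2 / real C \<le> \<epsilon> / 3" using C0 \<epsilon> by (auto simp: C_def field_simps)
  define \<delta> where "\<delta> = \<epsilon> / (6 * real C)"
  have \<delta>: "\<delta> > 0" using \<epsilon> C by (simp add: \<delta>_def)
  obtain K where K: "\<And>m. (\<Sum>a\<in>{a\<in>{1..2 ^ m}. a \<in> A}. 1 / real a) \<le> \<delta> * real m + K"
    using log_sum_density_zero[OF A \<delta>] by metis
  obtain k0 where k0: "real k0 > 6 * K / \<epsilon>" using reals_Archimedean2 by blast
  define k where "k = Suc k0"
  have k: "k > 0" "2 * K / real k \<le> \<epsilon> / 3" using k0 \<epsilon> by (auto simp: k_def field_simps)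
  \<comment> \<open>\<open>L\<close> is \<open>y ^ C\<close>, written as a power of two so that the
    bound on the sum of \<open>1 / a\<close> applies with \<open>m = k * C\<close>.\<close>
  define y L :: nat where "y = 2 ^ k" and "L = 2 ^ (k * C)"
  have L: "L > 1" unfolding L_def using k C by (intro one_less_power) auto
  let ?B = "{a\<in>{1..L}. a \<in> A}"
  define \<rho> where "\<rho> = rough_density y"
  have \<rho>0: "\<rho> \<ge> 0" by (simp add: \<rho>_def rough_density_def)
  \<comment> \<open>The harmonic sum up to \<open>y = 2 ^ k\<close> is at least
    \<open>k / 2\<close>, which forces \<open>\<rho> \<le> 2 / k\<close>.\<close>
  have "\<rho> * (real k / 2) \<le> \<rho> * (\<Sum>s\<in>{1..y}. 1 / real s)"
    unfolding y_def by (intro mult_left_mono harmonic_dyadic_ge \<rho>0)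
  also have "\<dots> \<le> 1" unfolding \<rho>_def by (rule rough_density_harmonic_le)
  finally have \<rho>: "\<rho> \<le> 2 / real k" using k by (simp add: field_simps)
  have 1: "density_le {n. smooth_part y n > L} (2 / real C)"
  proof -
    have "ln (4::real) = 2 * ln 2" using ln_realpow[of 2 2] by simp
    then have "real k * ln 4 / ln (real L) = 2 / real C"
      using k by (simp add: L_def ln_realpow)
    with density_le_smooth_part_gt[OF L, of k] show ?thesis by (simp add: y_def)
  qed
  have 2: "density_le (\<Union>a\<in>?B. {n. smooth_part y n = a}) (\<Sum>a\<in>?B. \<rho> / real a)"
    unfolding \<rho>_def by (intro density_le_UN density_le_smooth_part_eq) auto
  have sum0: "(\<Sum>a\<in>?B. 1 / real a) \<ge> 0" by (intro sum_nonneg) simp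
  have "(\<Sum>a\<in>?B. \<rho> / real a) = \<rho> * (\<Sum>a\<in>?B. 1 / real a)"
    by (simp add: sum_distrib_left)
  also have "\<dots> \<le> 2 / real k * (\<Sum>a\<in>?B. 1 / real a)"
    by (intro mult_right_mono \<rho> sum0)
  also have "\<dots> \<le> 2 / real k * (\<delta> * real (k * C) + K)"
    unfolding L_def by (intro mult_left_mono K) simp
  also have "\<dots> = 2 * \<delta> * real C + 2 * K / real k" using k by (simp add: field_simps)
  also have "2 * \<delta> * real C = \<epsilon> / 3" using C by (simp add: \<delta>_def)
  finally have "2 / real C + (\<Sum>a\<in>?B. \<rho> / real a) \<le> \<epsilon>" using k C by linarith
  then have "density_le {n. smooth_part y n \<in> A} \<epsilon>"
  proof (rule density_le_mono[OF density_le_Un[OF 1 2], rotated])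
    fix n assume "n \<in> {n. smooth_part y n \<in> A}"
    then show "n \<in> {n. smooth_part y n > L} \<union> (\<Union>a\<in>?B. {n. smooth_part y n = a})"
      using smooth_part_pos[of y n] by auto
  qed
  then show thesis by (rule that)
qed

section \<open>Prime terms of strong divisibility sequences\<close>

text \<open>Take the least divisor \<open>d\<close> of \<open>s\<close> with
  \<open>x d \<noteq> 1\<close> and a prime \<open>q\<close> dividing it. If removing
  \<open>q\<close> from \<open>n\<close> left \<open>m\<close> with \<open>x m \<noteq> 1\<close>,
  then \<open>x d\<close> and \<open>x m\<close> would both be the prime \<open>x n\<close>, hence
  so would \<open>x (gcd d m)\<close>. Minimality gives \<open>gcd d m = d\<close>, so
  \<open>q\<close> divides \<open>m\<close>, a contradiction.\<close>

lemma sds_prime_term_cases: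
  assumes sds: "strong_divisibility_sequence x" and x1: "x 1 = 1"
    and n: "n \<ge> 1" "prime (x n)" and s: "s dvd n" "x s \<noteq> 1"
  obtains q where "prime q" "q dvd s" "x (n div q ^ multiplicity q n) = 1"
proof -
  have gcd_x: "gcd (x a) (x b) = x (gcd a b)" if "a \<ge> 1" "b \<ge> 1" for a b
    using sds that unfolding strong_divisibility_sequence_def by blast
  have x_cases: "x d = 1 \<or> x d = x n" if "d dvd n" for d
  proof -
    have "d \<ge> 1" using that n(1) by (cases d) auto
    then have "gcd (x d) (x n) = x d" using gcd_x[of d n] n(1) that by (simp add: gcd_nat.absorb1)
    then have "x d dvd x n" by (metis gcd_dvd2)
    then show ?thesis using n(2) by (simp add: prime_nat_iff)
  qed
  define d where "d = (LEAST d. d dvd n \<and> d dvd s \<and> x d \<noteq> 1)"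
  have d: "d dvd n" "d dvd s" "x d \<noteq> 1"
    using LeastI[of "\<lambda>d. d dvd n \<and> d dvd s \<and> x d \<noteq> 1" s] s unfolding d_def by auto
  have d0: "d \<ge> 1" using d(1) n(1) by (cases d) auto
  have "d \<noteq> 1" using d(3) x1 by auto
  then obtain q where q: "prime q" "q dvd d" using prime_factor_nat by blast
  define m where "m = n div q ^ multiplicity q n"
  have mdvd: "m dvd n" unfolding m_def by (metis dvd_div_mult_self dvd_triv_left multiplicity_dvd)
  have m0: "m \<ge> 1" using mdvd n(1) by (cases m) auto
  have qm: "\<not> q dvd m" unfolding m_def using n(1) q by (intro multiplicity_decompose) auto
  have "x m = 1"
  proof (rule ccontr)
    assume "x m \<noteq> 1"
    then have "x m = x n" "x d = x n" using x_cases mdvd d by blast+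
    then have "x (gcd d m) = x n" using gcd_x[OF d0 m0] by simp
    then have "x (gcd d m) \<noteq> 1" using n(2) by auto
    moreover have "gcd d m dvd n" "gcd d m dvd s" using d by (auto intro: dvd_trans)
    ultimately have "d \<le> gcd d m" unfolding d_def by (intro Least_le) auto
    then have "gcd d m = d" using d0 by (simp add: dvd_imp_le le_antisym)
    then show False using q qm by (metis dvd_trans gcd_dvd2)
  qed
  then show thesis using that[of q] q d(2) unfolding m_def by (meson dvd_trans)
qed

theorem theorem1p5:
  fixes x :: "nat \<Rightarrow> nat"
  assumes "strong_divisibility_sequence x"
    and "x 1 = 1"
    and "has_natural_density {n. n \<ge> 1 \<and> x n = 1} 0"
  shows "has_natural_density {n. n \<ge> 1 \<and> prime (x n)} 0"
  unfolding density_zero_iff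
proof (intro allI impI)
  fix c :: real assume c: "c > 0"
  let ?A = "{n. n \<ge> 1 \<and> x n = 1}"
  \<comment> \<open>Once \<open>y\<close> is fixed, only finitely many primes \<open>q\<close> can
    occur, so their union \<open>?R\<close> has density zero however large \<open>y\<close>
    is.\<close>
  obtain y where y: "density_le {n. smooth_part y n \<in> ?A} (c / 2)"
    using density_smooth_part_mem[OF assms(3), of "c / 2"] c by auto
  let ?P = "{p. prime p \<and> p \<le> y}"
  let ?R = "\<Union>q\<in>?P. {n. n div q ^ multiplicity q n \<in> ?A}"
  have "has_natural_density ?R 0"
    by (intro density_zero_UN density_zero_remove_prime assms(3) finite_primes_le) auto
  then have R: "density_le ?R (c / 2)" using c by (simp add: density_zero_iff)
  show "density_le {n. n \<ge> 1 \<and> prime (x n)} c"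
  proof (rule density_le_mono[OF density_le_Un[OF y R]])
    fix n assume n: "n \<ge> 1" "n \<in> {n. n \<ge> 1 \<and> prime (x n)}"
    show "n \<in> {n. smooth_part y n \<in> ?A} \<union> ?R"
    proof (cases "x (smooth_part y n) = 1")
      case True
      then show ?thesis using smooth_part_pos[of y n] by simp
    next
      case False
      from n have "prime (x n)" by simp
      from sds_prime_term_cases[OF assms(1,2) n(1) this smooth_part_dvd False]
      obtain q where q: "prime q" "q dvd smooth_part y n" "x (n div q ^ multiplicity q n) = 1" .
      from q(1,2) have "multiplicity q (smooth_part y n) > 0"
        using smooth_part_pos[of y n] by (simp add: prime_multiplicity_gt_zero_iff)
      then have "q \<le> y" using q(1) by (simp add: multiplicity_smooth_part split: if_splits)
      moreover have "n div q ^ multiplicity q n \<ge> 1"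
        using n(1) q(1) multiplicity_dvd[of q n]
        by (simp add: Suc_le_eq div_greater_zero_iff dvd_imp_le prime_gt_0_nat)
      ultimately show ?thesis using q by auto
    qed
  qed simp
qed

end
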